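(* For $n\in\mathbb{N}$ let $H_n:=\{(x,y)\in\mathbb{R}_{\ge0}^2: xy\ge n\}$. There is an algorithm that, with input $n\in\mathbb{N}$ and a vertex $\mathbf p=(\mathbf p_x,\mathbf p_y)$ of $\mathrm{conv}(H_n\cap\mathbb{Z}^2)$, finds the next vertex $\mathbf p'=(\mathbf p'_x,\mathbf p'_y)$ using at most $O(\log n)$ arithmetic operations. Here "next" means that \[ \mathbf p'_x=\min\{x>\mathbf p_x : (x,y)\in \mathrm{vert}(\mathrm{conv}(H_n\cap\mathbb{Z}^2)) \text{ for some } y\}. \]
   Context: Complexity is measured in the arithmetic (RAM) model: comparisons, additions, subtractions, multiplications, integer divisions $\lfloor b/a\rfloor$ and integer square roots $\lfloor\sqrt a\rfloor$ each cost $O(1)$. $\mathrm{conv}$ denotes convex hull and $\mathrm{vert}$ the set of vertices. *)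

theory Defs
  imports "HOL-Analysis.Analysis" "HOL-Library.Landau_Symbols"
begin

definition hyperbola_region :: "nat \<Rightarrow> (real \<times> real) set" where
  "hyperbola_region n = {(x, y). 0 \<le> x \<and> 0 \<le> y \<and> x * y \<ge> real n}"

definition integer_points :: "(real \<times> real) set" where
  "integer_points = \<int> \<times> \<int>"

definition hull_vertices :: "nat \<Rightarrow> (real \<times> real) set" where
  "hull_vertices n =
     {v. v extreme_point_of (convex hull (hyperbola_region n \<inter> integer_points))}"

lemma hull_vertices_integral: "hull_vertices n \<subseteq> integer_points"
  unfolding hull_vertices_def using extreme_point_of_convex_hull by blast

definition next_vertex :: "nat \<Rightarrow> real \<times> real \<Rightarrow> real \<times> real \<Rightarrow> bool" where
  "next_vertex n p p' \<longleftrightarrow>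
     p' \<in> hull_vertices n \<and>
     fst p' \<in> {x. x > fst p \<and> (\<exists>y. (x, y) \<in> hull_vertices n)} \<and>
     (\<forall>x \<in> {x. x > fst p \<and> (\<exists>y. (x, y) \<in> hull_vertices n)}. fst p' \<le> x)"

text \<open>
  The arithmetic RAM: programs over an unbounded memory of integer cells with computed
  addresses. The cost of a run charges one unit for every arithmetic operation and comparison,
  and also for every constant, memory access and \<open>Skip\<close>; since every loop iteration performs a
  comparison, the extra charges change the cost by at most a factor depending only on the
  program.
\<close>

type_synonym mem = "int \<Rightarrow> int"

datatype aexp =
    Const int
  | Load aexp
  | Plus aexp aexp
  | Minus aexp aexp
  | Times aexp aexp
  | IntDiv aexp aexp
  | IntSqrt aexp

datatype test =
    Less aexp aexp
  | LessEq aexp aexp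
  | Equal aexp aexp

datatype com =
    Skip
  | Store aexp aexp
  | Seq com com
  | Cond test com com
  | While test com

text \<open>
  On \<^typ>\<open>int\<close>, \<open>b div a\<close> is the floor of the quotient. The values for a zero divisor
  and for the root of a negative number are mere totality conventions.
\<close>

fun aval :: "mem \<Rightarrow> aexp \<Rightarrow> int" where
  "aval m (Const k) = k"
| "aval m (Load e) = m (aval m e)"
| "aval m (Plus e f) = aval m e + aval m f"
| "aval m (Minus e f) = aval m e - aval m f"
| "aval m (Times e f) = aval m e * aval m f"
| "aval m (IntDiv e f) = aval m e div aval m f"
| "aval m (IntSqrt e) = \<lfloor>sqrt (real_of_int (aval m e))\<rfloor>"

fun acost :: "aexp \<Rightarrow> nat" where
  "acost (Const k) = 1"
| "acost (Load e) = acost e + 1"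
| "acost (Plus e f) = acost e + acost f + 1"
| "acost (Minus e f) = acost e + acost f + 1"
| "acost (Times e f) = acost e + acost f + 1"
| "acost (IntDiv e f) = acost e + acost f + 1"
| "acost (IntSqrt e) = acost e + 1"

fun tval :: "mem \<Rightarrow> test \<Rightarrow> bool" where
  "tval m (Less e f) \<longleftrightarrow> aval m e < aval m f"
| "tval m (LessEq e f) \<longleftrightarrow> aval m e \<le> aval m f"
| "tval m (Equal e f) \<longleftrightarrow> aval m e = aval m f"

fun tcost :: "test \<Rightarrow> nat" where
  "tcost (Less e f) = acost e + acost f + 1"
| "tcost (LessEq e f) = acost e + acost f + 1"
| "tcost (Equal e f) = acost e + acost f + 1"

text \<open>\<open>exec c m t m'\<close>: started in memory \<open>m\<close>, program \<open>c\<close> halts in memory \<open>m'\<close> at cost \<open>t\<close>.\<close>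

inductive exec :: "com \<Rightarrow> mem \<Rightarrow> nat \<Rightarrow> mem \<Rightarrow> bool" where
  exec_Skip: "exec Skip m 1 m"
| exec_Store: "exec (Store e f) m (acost e + acost f + 1) (m(aval m e := aval m f))"
| exec_Seq: "exec c m s m' \<Longrightarrow> exec d m' t m'' \<Longrightarrow> exec (Seq c d) m (s + t) m''"
| exec_CondT: "tval m b \<Longrightarrow> exec c m t m' \<Longrightarrow> exec (Cond b c d) m (tcost b + t) m'"
| exec_CondF: "\<not> tval m b \<Longrightarrow> exec d m t m' \<Longrightarrow> exec (Cond b c d) m (tcost b + t) m'"
| exec_WhileF: "\<not> tval m b \<Longrightarrow> exec (While b c) m (tcost b) m"
| exec_WhileT: "tval m b \<Longrightarrow> exec c m s m' \<Longrightarrow> exec (While b c) m' t m'' \<Longrightarrow>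
    exec (While b c) m (tcost b + s + t) m''"

inductive_cases exec_SkipE: "exec Skip m t m'"
inductive_cases exec_StoreE: "exec (Store e f) m t m'"
inductive_cases exec_SeqE: "exec (Seq c d) m t m'"
inductive_cases exec_CondE: "exec (Cond b c d) m t m'"
inductive_cases exec_WhileE: "exec (While b c) m t m'"

lemma exec_deterministic:
  "exec c m t m' \<Longrightarrow> exec c m u m'' \<Longrightarrow> u = t \<and> m'' = m'"
proof (induction arbitrary: u m'' rule: exec.induct)
  case exec_Skip then show ?case by (auto elim: exec_SkipE)
next
  case exec_Store then show ?case by (auto elim: exec_StoreE)
next
  case exec_Seq from exec_Seq.prems show ?case
    by (rule exec_SeqE) (use exec_Seq.IH in blast)
next
  case exec_CondT from exec_CondT.prems show ?case
    by (rule exec_CondE) (use exec_CondT.IH exec_CondT.hyps in blast)+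
next
  case exec_CondF from exec_CondF.prems show ?case
    by (rule exec_CondE) (use exec_CondF.IH exec_CondF.hyps in blast)+
next
  case exec_WhileF from exec_WhileF.prems show ?case
    by (rule exec_WhileE) (use exec_WhileF.hyps in blast)+
next
  case exec_WhileT from exec_WhileT.prems show ?case
    by (rule exec_WhileE) (use exec_WhileT.IH exec_WhileT.hyps in blast)+
qed

definition input_mem :: "nat \<Rightarrow> int \<Rightarrow> int \<Rightarrow> mem" where
  "input_mem n a b = (\<lambda>_. 0)(0 := int n, 1 := a, 2 := b)"

end

theory Submission
  imports Defs
begin

text \<open>
  From a vertex \<open>(a, b)\<close> a step \<open>(u, v)\<close> leads to \<open>(a + u, b - v)\<close>; it is admissible if
  \<open>(a + u) (b - v) \<ge> n\<close>. The next vertex is the last admissible multiple of the primitive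
  admissible step \<open>L\<close> of largest slope \<open>v/u\<close>.

  To find \<open>L\<close>, keep a basis \<open>L\<close>, \<open>R\<close> of the integer lattice with \<open>L\<close> admissible and \<open>R\<close> steeper
  than every admissible step. If some admissible step is steeper than \<open>L\<close>, then, by convexity,
  some \<open>R + kL\<close> with an integer \<open>k \<ge> 0\<close> is admissible. So \<open>L\<close> is first replaced by the last
  admissible \<open>L + jR\<close>, and then, for the least \<open>k\<close> with \<open>R + kL\<close> admissible, \<open>R\<close> is replaced by
  \<open>R + (k - 1)L\<close>; if there is no such \<open>k\<close>, then \<open>L\<close> is optimal. Both \<open>j\<close> and \<open>k\<close> come from
  integer roots of quadratics, so each round takes constantly many operations. A round at least
  doubles the first coordinate of \<open>R\<close>, which stays below \<open>n\<close>, hence there are \<open>O(log n)\<close> rounds.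
\<close>

section \<open>Integer roots of concave quadratics\<close>

text \<open>The larger root of \<open>C + B * k - A * (k * k)\<close>, rounded down. Flooring the
  square root first loses nothing, because it is only compared with the integer
  \<open>2 * A * k - B\<close>.\<close>

definition max_root :: "int \<Rightarrow> int \<Rightarrow> int \<Rightarrow> int" where
  "max_root A B C = (B + \<lfloor>sqrt (real_of_int (B * B + 4 * (A * C)))\<rfloor>) div (2 * A)"

text \<open>The smaller root, rounded up; the ceiling is written as a negated floor
  division.\<close>

definition min_root :: "int \<Rightarrow> int \<Rightarrow> int \<Rightarrow> int" where
  "min_root A B C = - ((\<lfloor>sqrt (real_of_int (B * B + 4 * (A * C)))\<rfloor> - B) div (2 * A))"

lemma le_div_iff_int:
  fixes k z d :: int
  assumes "0 < d"
  shows "k \<le> z div d \<longleftrightarrow> k * d \<le> z"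
proof
  assume "k \<le> z div d"
  then have "k * d \<le> z div d * d" using assms by (simp add: mult_right_mono)
  also have "\<dots> \<le> z" using assms by (simp add: minus_mod_eq_div_mult [symmetric])
  finally show "k * d \<le> z" .
next
  assume "k * d \<le> z"
  then have "k * d div d \<le> z div d" using assms by (simp only: zdiv_mono1)
  then show "k \<le> z div d" using assms by simp
qed

lemma minus_div_le_iff_int:
  fixes k z d :: int
  assumes "0 < d"
  shows "- (z div d) \<le> k \<longleftrightarrow> - z \<le> k * d"
  using le_div_iff_int[OF assms, of "- k" z] by auto

text \<open>For \<open>D < 0\<close> both sides fail, since \<open>sqrt\<close> of a negative real
  is negative in HOL.\<close>

lemma abs_le_floor_sqrt_iff:
  fixes z D :: int
  shows "\<bar>z\<bar> \<le> \<lfloor>sqrt (real_of_int D)\<rfloor> \<longleftrightarrow> z * z \<le> D"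
proof -
  have "\<bar>z\<bar> \<le> \<lfloor>sqrt (real_of_int D)\<rfloor> \<longleftrightarrow> \<bar>real_of_int z\<bar> \<le> sqrt (real_of_int D)"
    by (simp add: le_floor_iff)
  also have "\<dots> \<longleftrightarrow> sqrt ((real_of_int z)\<^sup>2) \<le> sqrt (real_of_int D)"
    by simp
  also have "\<dots> \<longleftrightarrow> real_of_int (z * z) \<le> real_of_int D"
    by (simp only: real_sqrt_le_iff power2_eq_square of_int_mult)
  finally show ?thesis by (simp only: of_int_le_iff)
qed

text \<open>Multiply by \<open>4 * A\<close> and complete the square.\<close>

lemma quadratic_nonneg_iff:
  fixes A B C k :: int
  assumes "0 < A"
  shows "0 \<le> C + B * k - A * (k * k) \<longleftrightarrow>
    \<bar>2 * A * k - B\<bar> \<le> \<lfloor>sqrt (real_of_int (B * B + 4 * (A * C)))\<rfloor>"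
proof -
  have "4 * A * (C + B * k - A * (k * k)) =
      B * B + 4 * (A * C) - (2 * A * k - B) * (2 * A * k - B)"
    by (simp add: algebra_simps)
  moreover have "0 \<le> C + B * k - A * (k * k) \<longleftrightarrow> 0 \<le> 4 * A * (C + B * k - A * (k * k))"
    using assms by (simp add: zero_le_mult_iff)
  ultimately show ?thesis unfolding abs_le_floor_sqrt_iff by linarith
qed

text \<open>As \<open>0 \<le> C\<close>, zero is a solution; the integer solutions form an interval
  containing it, with upper end \<open>k\<close>.\<close>

lemma max_root:
  fixes A B C :: int
  assumes "0 < A" and "0 \<le> C"
  defines "k \<equiv> max_root A B C"
  shows "0 \<le> k" and "0 \<le> C + B * k - A * (k * k)"
    and "\<And>j. k < j \<Longrightarrow> C + B * j - A * (j * j) < 0"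
proof -
  define s where "s = \<lfloor>sqrt (real_of_int (B * B + 4 * (A * C)))\<rfloor>"
  have iff: "0 \<le> C + B * j - A * (j * j) \<longleftrightarrow> \<bar>2 * A * j - B\<bar> \<le> s" for j
    using quadratic_nonneg_iff[OF assms(1)] by (simp add: s_def)
  have le: "j \<le> k \<longleftrightarrow> j * (2 * A) \<le> B + s" for j
    using assms(1) by (simp add: k_def max_root_def s_def le_div_iff_int)
  have zero: "\<bar>2 * A * 0 - B\<bar> \<le> s" using iff[of 0] assms by simp
  then show "0 \<le> k" using le[of 0] by simp
  then have "0 \<le> 2 * A * k" using assms by simp
  moreover have "k * (2 * A) \<le> B + s" using le[of k] by simp
  ultimately have "\<bar>2 * A * k - B\<bar> \<le> s" using zero by (auto simp: algebra_simps abs_le_iff)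
  then show "0 \<le> C + B * k - A * (k * k)" using iff by simp
  show "C + B * j - A * (j * j) < 0" if "k < j" for j
    using that le[of j] iff[of j] by (auto simp: algebra_simps abs_le_iff)
qed

text \<open>For a negative discriminant \<^term>\<open>min_root A B C\<close> is a junk value, which is why callers
  check the sign of the quadratic there; by the second claim that check decides whether any
  nonnegative solution exists.\<close>

lemma min_root:
  fixes A B C :: int
  assumes "0 < A" and "C < 0"
  defines "k \<equiv> min_root A B C"
  shows "j < k \<Longrightarrow> C + B * j - A * (j * j) < 0"
    and "\<lbrakk>k \<le> 0 \<or> C + B * k - A * (k * k) < 0; 0 \<le> j\<rbrakk> \<Longrightarrow> C + B * j - A * (j * j) < 0"
proof -
  define s where "s = \<lfloor>sqrt (real_of_int (B * B + 4 * (A * C)))\<rfloor>"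
  have iff: "0 \<le> C + B * j - A * (j * j) \<longleftrightarrow> \<bar>2 * A * j - B\<bar> \<le> s" for j
    using quadratic_nonneg_iff[OF assms(1)] by (simp add: s_def)
  have le: "k \<le> j \<longleftrightarrow> B - s \<le> j * (2 * A)" for j
    using assms(1) by (simp add: k_def min_root_def s_def minus_div_le_iff_int)
  show "C + B * j - A * (j * j) < 0" if "j < k"
    using that le[of j] iff[of j] by (auto simp: algebra_simps abs_le_iff)
  show "C + B * j - A * (j * j) < 0" if k: "k \<le> 0 \<or> C + B * k - A * (k * k) < 0" and "0 \<le> j"
  proof (rule ccontr)
    assume "\<not> C + B * j - A * (j * j) < 0"
    then have j: "\<bar>2 * A * j - B\<bar> \<le> s" unfolding iff[symmetric] by simp
    then have "k \<le> j" using le[of j] by (auto simp: algebra_simps abs_le_iff)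
    \<comment> \<open>All integers from \<open>k\<close> to a solution \<open>j\<close> are
      solutions. This covers \<open>k\<close> itself and, if \<open>k \<le> 0\<close>, also
      \<open>0\<close>, where the quadratic has the negative value \<open>C\<close>.\<close>
    have below: "0 \<le> C + B * i - A * (i * i)" if "k \<le> i" "i \<le> j" for i
    proof -
      have "i * A \<le> j * A" using that assms(1) by simp
      moreover have "B - s \<le> i * (2 * A)" using that le by simp
      ultimately show ?thesis using j unfolding iff by (auto simp: algebra_simps abs_le_iff)
    qed
    show False using k below[of k] below[of 0] \<open>k \<le> j\<close> \<open>0 \<le> j\<close> assms(2) by auto
  qed
qed

section \<open>The walk towards the steepest admissible step\<close>

text \<open>AM-GM: the square of the sum is at least \<open>4 * (x * y') * (x' * y)\<close>, which
  regroups to \<open>4 * (x * y) * (x' * y')\<close> and so is at least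
  \<open>4 * n * n\<close>.\<close>

lemma cross_products_ge:
  fixes n x y x' y' :: int
  assumes "0 \<le> n" "0 \<le> x" "0 \<le> y" "0 \<le> x'" "0 \<le> y'" "n \<le> x * y" "n \<le> x' * y'"
  shows "2 * n \<le> x * y' + x' * y"
proof (rule ccontr)
  assume "\<not> ?thesis"
  moreover have "0 \<le> x * y' + x' * y" using assms by simp
  moreover from calculation have "0 < n" by linarith
  ultimately have "(x * y' + x' * y) * (x * y' + x' * y) < (2 * n) * (2 * n)"
    using assms by (intro mult_strict_mono) auto
  moreover have "4 * (x * y') * (x' * y) \<le> (x * y' + x' * y) * (x * y' + x' * y)"
    using zero_le_square[of "x * y' - x' * y"] by (simp add: algebra_simps)
  moreover have "n * n \<le> (x * y) * (x' * y')" using assms by (intro mult_mono) auto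
  ultimately show False by (simp add: algebra_simps)
qed

text \<open>Convexity of the region, with weights scaled to integers of sum \<open>w\<close>. In the
  expansion of \<open>(w * x) * (w * y)\<close> each square of a weight has a factor at least
  \<open>n\<close> and each mixed product a factor at least \<open>2 * n\<close>, which adds up to
  \<open>w * w * n\<close>.\<close>

lemma hyperbola_barycenter:
  fixes n w x y w1 x1 y1 w2 x2 y2 w3 x3 y3 :: int
  assumes "0 \<le> n" "0 < w" "w = w1 + w2 + w3" "0 \<le> w1" "0 \<le> w2" "0 \<le> w3"
    and "0 \<le> x1" "0 \<le> y1" "n \<le> x1 * y1"
    and "0 \<le> x2" "0 \<le> y2" "n \<le> x2 * y2"
    and "0 \<le> x3" "0 \<le> y3" "n \<le> x3 * y3"
    and wx: "w * x = w1 * x1 + w2 * x2 + w3 * x3" and wy: "w * y = w1 * y1 + w2 * y2 + w3 * y3"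
  shows "n \<le> x * y"
proof -
  have "2 * n \<le> x1 * y2 + x2 * y1" "2 * n \<le> x1 * y3 + x3 * y1" "2 * n \<le> x2 * y3 + x3 * y2"
    by (rule cross_products_ge; use assms in simp)+
  then have "(w1 * w2) * (2 * n) \<le> (w1 * w2) * (x1 * y2 + x2 * y1)"
    "(w1 * w3) * (2 * n) \<le> (w1 * w3) * (x1 * y3 + x3 * y1)"
    "(w2 * w3) * (2 * n) \<le> (w2 * w3) * (x2 * y3 + x3 * y2)"
    using assms by (simp_all add: mult_left_mono)
  moreover have "(w1 * w1) * n \<le> (w1 * w1) * (x1 * y1)" "(w2 * w2) * n \<le> (w2 * w2) * (x2 * y2)"
    "(w3 * w3) * n \<le> (w3 * w3) * (x3 * y3)"
    using assms by (simp_all add: mult_left_mono)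
  moreover have "(w * w) * n = (w1 * w1) * n + (w2 * w2) * n + (w3 * w3) * n
      + (w1 * w2) * (2 * n) + (w1 * w3) * (2 * n) + (w2 * w3) * (2 * n)"
    by (simp add: \<open>w = w1 + w2 + w3\<close> algebra_simps)
  moreover have "(w * w) * (x * y) = (w * x) * (w * y)" by (simp add: algebra_simps)
  moreover have "\<dots> = (w1 * w1) * (x1 * y1) + (w2 * w2) * (x2 * y2) + (w3 * w3) * (x3 * y3)
      + (w1 * w2) * (x1 * y2 + x2 * y1) + (w1 * w3) * (x1 * y3 + x3 * y1)
      + (w2 * w3) * (x2 * y3 + x3 * y2)"
    unfolding wx wy by (simp add: algebra_simps)
  ultimately have "(w * w) * n \<le> (w * w) * (x * y)" by linarith
  then show ?thesis using \<open>0 < w\<close> by (simp add: mult_le_cancel_left)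
qed

text \<open>What the walk uses of \<open>(a, b)\<close> being a vertex with a successor;
  \<open>hull_walk_from_vertex\<close> derives it.\<close>

locale hull_walk =
  fixes n a b :: int
  assumes n_pos: "1 \<le> n" and a_pos: "1 \<le> a" and b_ge: "2 \<le> b"
    and start_above: "n \<le> a * b" and start_low: "a * (b - 1) < n"
begin

definition slack :: "int \<Rightarrow> int \<Rightarrow> int" where
  "slack u v = (a + u) * (b - v) - n"

text \<open>The right-hand side has the form handled by \<open>max_root\<close> and
  \<open>min_root\<close>, so a search along a line takes constantly many operations.\<close>

lemma slack_line:
  "slack (u + k * u') (v + k * v') =
     slack u v + (u' * (b - v) - v' * (a + u)) * k - (u' * v') * (k * k)"
  by (simp add: slack_def algebra_simps)

text \<open>The product in \<open>slack\<close> must be positive and its first factor is, so an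
  admissible step ends above the x-axis and not on the other branch of the hyperbola.\<close>

lemma slack_nonneg_height:
  assumes "0 \<le> u" "0 \<le> slack u v"
  shows "v < b"
proof (rule ccontr)
  assume "\<not> v < b"
  then have "(a + u) * (b - v) \<le> 0" using assms a_pos by (simp add: mult_nonneg_nonpos)
  then show False using assms n_pos by (simp add: slack_def)
qed

text \<open>The triangle with corners \<open>0\<close>, \<open>L = (u1, v1)\<close> and \<open>iL + jR\<close>, where \<open>R = (u2, v2)\<close>, meets
  the line \<open>R + \<real>L\<close> in the parameters from \<open>i/j\<close> to \<open>(i + j - 1)/j\<close>; one of the \<open>j\<close> consecutive
  numerators is divisible by \<open>j\<close>.\<close>

lemma cone_slack:
  assumes "0 \<le> u1" "0 \<le> slack u1 v1" "0 \<le> u2" "0 \<le> i" "1 \<le> j"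
    and "0 \<le> slack (i * u1 + j * u2) (i * v1 + j * v2)"
  obtains k where "0 \<le> k" "k * j < i + j" "0 \<le> slack (u2 + k * u1) (v2 + k * v1)"
proof -
  \<comment> \<open>\<open>k\<close> is the ceiling of \<open>i / j\<close>, and
    \<open>r = k * j - i\<close> is the rounding defect. Then \<open>R + kL\<close> is the mean of
    \<open>iL + jR\<close>, \<open>L\<close> and \<open>0\<close> with weights \<open>1\<close>,
    \<open>r\<close> and \<open>j - 1 - r\<close>.\<close>
  define k where "k = - ((- i) div j)"
  have k_le: "k \<le> l \<longleftrightarrow> i \<le> l * j" for l
    using minus_div_le_iff_int[of j "- i" l] assms by (simp add: k_def)
  define r where "r = k * j - i"
  have r: "0 \<le> r" "r < j" using k_le[of k] k_le[of "k - 1"] by (auto simp: r_def algebra_simps)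
  have "0 \<le> k"
  proof (rule ccontr)
    assume "\<not> 0 \<le> k"
    then have "k * j < 0" using assms by (simp add: mult_neg_pos)
    then show False using r assms by (simp add: r_def)
  qed
  have v1: "v1 < b" by (rule slack_nonneg_height[OF assms(1,2)])
  have v3: "i * v1 + j * v2 < b" by (rule slack_nonneg_height[OF _ assms(6)]) (use assms in simp)
  have i: "i = k * j - r" by (simp add: r_def)
  have "n \<le> (a + (u2 + k * u1)) * (b - (v2 + k * v1))"
  proof (rule hyperbola_barycenter)
    show "n \<le> (a + (i * u1 + j * u2)) * (b - (i * v1 + j * v2))" "n \<le> (a + u1) * (b - v1)"
      using assms by (simp_all add: slack_def)
    show "n \<le> a * b" by (rule start_above)
    show "j = 1 + r + (j - 1 - r)" by simp
    show "j * (a + (u2 + k * u1)) =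
        1 * (a + (i * u1 + j * u2)) + r * (a + u1) + (j - 1 - r) * a"
      by (simp add: i algebra_simps)
    show "j * (b - (v2 + k * v1)) =
        1 * (b - (i * v1 + j * v2)) + r * (b - v1) + (j - 1 - r) * b"
      by (simp add: i algebra_simps)
  qed (use assms r v1 v3 n_pos a_pos b_ge in auto)
  then show ?thesis using that[of k] \<open>0 \<le> k\<close> r by (simp add: slack_def r_def)
qed

text \<open>Slopes are compared by cross products, so that the vertical vector \<open>(0, 1)\<close>
  is covered too; \<open>walk_inv_init_horizontal\<close> starts from it.\<close>

definition steep :: "int \<Rightarrow> int \<Rightarrow> bool" where
  "steep u2 v2 \<longleftrightarrow> (\<forall>u v. 1 \<le> u \<longrightarrow> 0 \<le> slack u v \<longrightarrow> v * u2 < u * v2)"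

lemma steepD:
  assumes "steep u2 v2" "1 \<le> u" "0 \<le> slack u v"
  shows "v * u2 < u * v2"
  using assms by (simp add: steep_def)

text \<open>Cramer's rule for a basis of determinant 1: the coordinates of a lattice vector are
  integers.\<close>

lemma basis_coordinates:
  fixes u v u1 v1 u2 v2 :: int
  assumes "u1 * v2 - u2 * v1 = 1"
  shows "(u * v2 - v * u2) * u1 + (u1 * v - v1 * u) * u2 = u"
    and "(u * v2 - v * u2) * v1 + (u1 * v - v1 * u) * v2 = v"
proof -
  have "(u * v2 - v * u2) * u1 + (u1 * v - v1 * u) * u2 = u * (u1 * v2 - u2 * v1)"
    "(u * v2 - v * u2) * v1 + (u1 * v - v1 * u) * v2 = v * (u1 * v2 - u2 * v1)"
    by (simp_all add: algebra_simps)
  then show "(u * v2 - v * u2) * u1 + (u1 * v - v1 * u) * u2 = u"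
    and "(u * v2 - v * u2) * v1 + (u1 * v - v1 * u) * v2 = v"
    using assms by simp_all
qed

text \<open>An admissible vector would have to be steeper than itself.\<close>

lemma steep_slack_neg:
  assumes "steep u v" "1 \<le> u"
  shows "slack u v < 0"
  using steepD[OF assms, of v] by (auto simp: mult.commute not_le[symmetric])

text \<open>A counterexample is \<open>iL + jR\<close> with
  \<open>1 \<le> i \<le> (k - 1) * j\<close>. Then \<open>cone_slack\<close> yields an admissible
  \<open>R + lL\<close> with \<open>l * j < i + j \<le> k * j\<close>, so \<open>l < k\<close>,
  against the minimality of \<open>k\<close>.\<close>

lemma steep_advance:
  assumes "0 \<le> u1" "0 \<le> slack u1 v1" "0 \<le> u2" "u1 * v2 - u2 * v1 = 1" "steep u2 v2"
    and "1 \<le> k" and least: "\<And>j. 0 \<le> j \<Longrightarrow> j < k \<Longrightarrow> slack (u2 + j * u1) (v2 + j * v1) < 0"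
  shows "steep (u2 + (k - 1) * u1) (v2 + (k - 1) * v1)"
  unfolding steep_def
proof (intro allI impI, rule ccontr)
  fix u v assume uv: "1 \<le> u" "0 \<le> slack u v"
    and not: "\<not> v * (u2 + (k - 1) * u1) < u * (v2 + (k - 1) * v1)"
  define i where "i = u * v2 - v * u2"
  define j where "j = u1 * v - v1 * u"
  have i: "1 \<le> i" using steepD[OF assms(5) uv] by (simp add: i_def)
  have ij: "i \<le> (k - 1) * j" using not by (simp add: i_def j_def algebra_simps)
  have j: "1 \<le> j"
  proof (rule ccontr)
    assume "\<not> 1 \<le> j"
    then have "(k - 1) * j \<le> 0" using \<open>1 \<le> k\<close> by (simp add: mult_nonneg_nonpos)
    then show False using i ij by simp
  qed
  have "0 \<le> slack (i * u1 + j * u2) (i * v1 + j * v2)"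
    using uv basis_coordinates[OF assms(4), of u v] by (simp add: i_def j_def)
  then obtain l where l: "0 \<le> l" "l * j < i + j" "0 \<le> slack (u2 + l * u1) (v2 + l * v1)"
    by (rule cone_slack[OF assms(1-3) _ j, rotated]) (use i in simp_all)
  have "l * j < k * j" using l ij by (simp add: algebra_simps)
  then have "l < k" using j by (simp add: mult_less_cancel_right)
  then show False using least[of l] l by simp
qed

text \<open>An admissible step steeper than \<open>L\<close> is \<open>iL + jR\<close> with
  \<open>i \<ge> 0\<close> and \<open>j \<ge> 1\<close>, so \<open>cone_slack\<close> would find an
  admissible point on the excluded half-line.\<close>

lemma steepest_if_line_avoids:
  assumes "0 \<le> u1" "0 \<le> slack u1 v1" "0 \<le> u2" "u1 * v2 - u2 * v1 = 1" "steep u2 v2"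
    and none: "\<And>j. 0 \<le> j \<Longrightarrow> slack (u2 + j * u1) (v2 + j * v1) < 0"
    and uv: "1 \<le> u" "0 \<le> slack u v"
  shows "v * u1 \<le> u * v1"
proof (rule ccontr)
  assume not: "\<not> v * u1 \<le> u * v1"
  define i where "i = u * v2 - v * u2"
  define j where "j = u1 * v - v1 * u"
  have i: "0 \<le> i" using steepD[OF assms(5) uv] by (simp add: i_def)
  have j: "1 \<le> j" using not by (simp add: j_def algebra_simps)
  have "0 \<le> slack (i * u1 + j * u2) (i * v1 + j * v2)"
    using uv basis_coordinates[OF assms(4), of u v] by (simp add: i_def j_def)
  then obtain l where "0 \<le> l" "0 \<le> slack (u2 + l * u1) (v2 + l * v1)"
    by (rule cone_slack[OF assms(1-3) i j])
  then show False using none[of l] by simp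
qed

text \<open>The last clause makes \<open>u2 \<le> u1\<close> hold after the admissible vector has been extended, which
  is what doubles \<open>u2\<close> in every round.\<close>

definition walk_inv :: "int \<Rightarrow> int \<Rightarrow> int \<Rightarrow> int \<Rightarrow> bool" where
  "walk_inv u1 v1 u2 v2 \<longleftrightarrow> 1 \<le> u1 \<and> 1 \<le> v1 \<and> 1 \<le> u2 \<and> 1 \<le> v2 \<and> u2 < n \<and>
     0 \<le> slack u1 v1 \<and> u1 * v2 - u2 * v1 = 1 \<and> steep u2 v2 \<and>
     (u2 \<le> u1 \<or> 0 \<le> slack (u1 + u2) (v1 + v2))"

text \<open>Here \<open>v\<close> is the deepest admissible descent for \<open>u = 1\<close>. If an
  admissible \<open>(u, w)\<close> had \<open>w \<ge> u * (v + 1)\<close>, then \<open>u\<close>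
  times \<open>(1, v + 1)\<close> would be admissible, and by convexity so would
  \<open>(1, v + 1)\<close>, which lies between it and the origin.\<close>

lemma walk_inv_init_diagonal:
  assumes "1 \<le> v" "0 \<le> slack 1 v" "slack 1 (v + 1) < 0" "1 < n"
  shows "walk_inv 1 v 1 (v + 1)"
proof -
  have "steep 1 (v + 1)"
    unfolding steep_def
  proof (intro allI impI, rule ccontr)
    fix u w assume uw: "1 \<le> u" "0 \<le> slack u w" and not: "\<not> w * 1 < u * (v + 1)"
    have w: "w < b" using uw by (intro slack_nonneg_height[of u]) auto
    have "(a + u) * (b - w) \<le> (a + u) * (b - u * (v + 1))"
      using uw not a_pos by (intro mult_left_mono) auto
    then have "n \<le> (a + u) * (b - u * (v + 1))" using uw by (simp add: slack_def)
    then have "n \<le> (a + 1) * (b - (v + 1))"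
      by (rule hyperbola_barycenter[where w = u and ?w1.0 = 1 and ?w2.0 = "u - 1" and ?w3.0 = 0
            and ?x2.0 = a and ?y2.0 = b and ?x3.0 = a and ?y3.0 = b, rotated 8])
        (use uw w not a_pos b_ge n_pos start_above in \<open>auto simp: algebra_simps\<close>)
    then show False using assms by (simp add: slack_def)
  qed
  then show ?thesis using assms by (simp add: walk_inv_def)
qed

text \<open>If no descent is possible for \<open>u = 1\<close>, then \<open>k\<close> is the least
  width of a descent by one. Steepness of \<open>(k - 1, 1)\<close> is one application of
  \<open>steep_advance\<close> to the standard basis \<open>(1, 0)\<close>,
  \<open>(0, 1)\<close>.\<close>

lemma walk_inv_init_horizontal:
  assumes "slack 1 1 < 0" "0 \<le> slack k 1" "slack (k - 1) 1 < 0"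
  shows "walk_inv k 1 (k - 1) 1"
proof -
  have mono: "slack u 1 \<le> slack w 1" if "u \<le> w" for u w
    using that b_ge by (simp add: slack_def mult_right_mono)
  have k: "2 \<le> k" using mono[of k 1] assms by linarith
  have "steep (0 + (k - 1) * 1) (1 + (k - 1) * 0)"
  proof (rule steep_advance)
    show "slack (0 + j * 1) (1 + j * 0) < 0" if "j < k" for j
      using mono[of j "k - 1"] assms that by simp
    show "0 \<le> slack 1 0" using start_above b_ge by (simp add: slack_def algebra_simps)
  qed (use k in \<open>auto simp: steep_def\<close>)
  moreover have "k - 1 < n"
  proof -
    have "(a + (k - 1)) * 1 \<le> (a + (k - 1)) * (b - 1)"
      using b_ge a_pos k by (intro mult_left_mono) auto
    then show ?thesis using assms a_pos by (simp add: slack_def)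
  qed
  ultimately show ?thesis using k assms by (simp add: walk_inv_def)
qed

text \<open>Adding multiples of \<open>R\<close> to \<open>L\<close> keeps the determinant. For
  \<open>j = 0\<close> the bound on \<open>u2\<close> comes from the last clause of the invariant,
  because \<open>L + R\<close> is inadmissible; for \<open>j \<ge> 1\<close> it is
  immediate.\<close>

lemma walk_extend:
  assumes inv: "walk_inv u1 v1 u2 v2"
  defines "j \<equiv> max_root (u2 * v2) (u2 * (b - v1) - v2 * (a + u1)) (slack u1 v1)"
  shows "walk_inv (u1 + j * u2) (v1 + j * v2) u2 v2"
    and "u2 \<le> u1 + j * u2"
    and "slack (u1 + j * u2 + u2) (v1 + j * v2 + v2) < 0"
proof -
  note I = inv[unfolded walk_inv_def]
  have A: "0 < u2 * v2" using I by simp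
  note root = max_root[OF A, of "slack u1 v1" "u2 * (b - v1) - v2 * (a + u1)", folded j_def,
      folded slack_line]
  have j: "0 \<le> j" and s: "0 \<le> slack (u1 + j * u2) (v1 + j * v2)" using root I by auto
  have "slack (u1 + (j + 1) * u2) (v1 + (j + 1) * v2) < 0" using root(3)[of "j + 1"] I by simp
  then show neg: "slack (u1 + j * u2 + u2) (v1 + j * v2 + v2) < 0"
    by (simp add: algebra_simps)
  have ju: "0 \<le> j * u2" "0 \<le> j * v2" using I j by auto
  show u: "u2 \<le> u1 + j * u2"
  proof (cases "j = 0")
    case True
    then show ?thesis using neg I by auto
  next
    case False
    then have "1 * u2 \<le> j * u2" using j I by (intro mult_right_mono) auto
    then have "u2 \<le> j * u2" by (simp only: mult_1)
    then show ?thesis using I by linarith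
  qed
  show "walk_inv (u1 + j * u2) (v1 + j * v2) u2 v2"
    using I s ju u by (auto simp: walk_inv_def algebra_simps)
qed

text \<open>Inadmissibility of \<open>L + R\<close> excludes \<open>k = 1\<close>. Hence
  \<open>R\<close> grows by at least one copy of \<open>L\<close>, whose first coordinate is at
  least \<open>u2\<close>: this is the doubling. The last clause of the new invariant is
  admissibility of \<open>R + kL\<close>.\<close>

lemma walk_advance:
  assumes inv: "walk_inv u1 v1 u2 v2" and u: "u2 \<le> u1"
    and neg: "slack (u1 + u2) (v1 + v2) < 0"
  defines "k \<equiv> min_root (u1 * v1) (u1 * (b - v2) - v1 * (a + u2)) (slack u2 v2)"
  assumes k: "0 < k" "0 \<le> slack (u2 + k * u1) (v2 + k * v1)"
  shows "walk_inv u1 v1 (u2 + (k - 1) * u1) (v2 + (k - 1) * v1)"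
    and "2 * u2 \<le> u2 + (k - 1) * u1"
proof -
  note I = inv[unfolded walk_inv_def]
  have A: "0 < u1 * v1" using I by simp
  have C: "slack u2 v2 < 0" using I steep_slack_neg by simp
  have least: "slack (u2 + j * u1) (v2 + j * v1) < 0" if "0 \<le> j" "j < k" for j
    using min_root(1)[OF A C, of j "u1 * (b - v2) - v1 * (a + u2)", folded k_def,
        folded slack_line] that k by simp
  have "k \<noteq> 1" using k neg by (auto simp: add.commute)
  then have k2: "2 \<le> k" using k by simp
  have "1 * u1 \<le> (k - 1) * u1" "1 * v1 \<le> (k - 1) * v1"
    using k2 I by (auto intro!: mult_right_mono)
  then have ge: "u1 \<le> (k - 1) * u1" "v1 \<le> (k - 1) * v1" by simp_all
  show "2 * u2 \<le> u2 + (k - 1) * u1" using ge u by simp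
  let ?u = "u2 + (k - 1) * u1" and ?v = "v2 + (k - 1) * v1"
  have steep: "steep ?u ?v" by (rule steep_advance) (use I k least in auto)
  have sum: "u1 + ?u = u2 + k * u1" "v1 + ?v = v2 + k * v1" by (simp_all add: algebra_simps)
  \<comment> \<open>The step \<open>R + kL\<close> ends above the x-axis, hence so does
    \<open>R + (k - 1)L\<close>. The latter is inadmissible and ends at height at least 1, so its
    abscissa is below \<open>n\<close>.\<close>
  have "?u < n"
  proof -
    have "0 \<le> u2 + k * u1" using I k by simp
    then have "v2 + k * v1 < b" using k slack_nonneg_height by blast
    then have v: "1 \<le> b - ?v" using sum I by linarith
    have u0: "0 \<le> ?u" using ge I by linarith
    have "a + ?u = (a + ?u) * 1" by simp
    also have "\<dots> \<le> (a + ?u) * (b - ?v)" using u0 v a_pos by (intro mult_left_mono) auto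
    also have "\<dots> < n" using least[of "k - 1"] k by (simp add: slack_def)
    finally show ?thesis using a_pos by linarith
  qed
  moreover have "u1 * ?v - ?u * v1 = 1" using I by (simp add: algebra_simps)
  moreover have "1 \<le> ?u" "1 \<le> ?v" using ge I by linarith+
  ultimately show "walk_inv u1 v1 ?u ?v"
    unfolding walk_inv_def sum using steep I k by blast
qed

text \<open>By \<open>min_root\<close>, this single test of \<open>k\<close> rules out all
  admissible \<open>R + jL\<close> with \<open>j \<ge> 0\<close>.\<close>

lemma walk_exit:
  assumes inv: "walk_inv u1 v1 u2 v2"
  defines "k \<equiv> min_root (u1 * v1) (u1 * (b - v2) - v1 * (a + u2)) (slack u2 v2)"
  assumes k: "k \<le> 0 \<or> slack (u2 + k * u1) (v2 + k * v1) < 0"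
    and uv: "1 \<le> u" "0 \<le> slack u v"
  shows "v * u1 \<le> u * v1"
proof -
  note I = inv[unfolded walk_inv_def]
  have A: "0 < u1 * v1" using I by simp
  have C: "slack u2 v2 < 0" using I steep_slack_neg by simp
  have none: "slack (u2 + j * u1) (v2 + j * v1) < 0" if "0 \<le> j" for j
    using min_root(2)[OF A C, of "u1 * (b - v2) - v1 * (a + u2)" j, folded k_def,
        folded slack_line] that k by simp
  show ?thesis by (rule steepest_if_line_avoids[of u1 v1 u2 v2]) (use I none uv in auto)
qed

end

section \<open>Vertices of the integer hull\<close>

lemma lattice_point_iff:
  "(real_of_int x, real_of_int y) \<in> hyperbola_region n \<inter> integer_points \<longleftrightarrow>
     0 \<le> x \<and> 0 \<le> y \<and> int n \<le> x * y"
proof -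
  have "real n \<le> real_of_int x * real_of_int y \<longleftrightarrow>
      real_of_int (int n) \<le> real_of_int (x * y)"
    by simp
  then show ?thesis
    unfolding hyperbola_region_def integer_points_def of_int_le_iff by auto
qed

lemma lattice_pointE:
  assumes "p \<in> hyperbola_region n \<inter> integer_points"
  obtains x y where "p = (real_of_int x, real_of_int y)" "0 \<le> x" "0 \<le> y" "int n \<le> x * y"
proof -
  obtain x y where p: "p = (real_of_int x, real_of_int y)"
    using assms by (auto simp: integer_points_def elim!: Ints_cases)
  then show ?thesis using that assms lattice_point_iff by blast
qed

lemma hull_vertexE:
  assumes "p \<in> hull_vertices n"
  obtains x y where "p = (real_of_int x, real_of_int y)" "0 \<le> x" "0 \<le> y" "int n \<le> x * y"
  using assms lattice_pointE extreme_point_of_convex_hull unfolding hull_vertices_def by blast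

lemma hull_vertex_not_between:
  assumes "p \<in> hull_vertices n"
    and "q \<in> convex hull (hyperbola_region n \<inter> integer_points)"
    and "r \<in> convex hull (hyperbola_region n \<inter> integer_points)"
  shows "p \<notin> open_segment q r"
  using assms by (auto simp: hull_vertices_def extreme_point_of_def)

text \<open>The region is closed upwards, so a vertex above \<open>(x, y0)\<close> would lie
  strictly between that point and \<open>(x, y + 1)\<close>.\<close>

lemma hull_vertex_lowest:
  assumes p: "(x, y) \<in> hull_vertices n"
    and q: "(x, y0) \<in> convex hull (hyperbola_region n \<inter> integer_points)"
  shows "y \<le> y0"
proof (rule ccontr)
  assume "\<not> y \<le> y0"
  then have less: "y0 < y" by simp
  obtain i j where ij: "x = real_of_int i" "y = real_of_int j" "0 \<le> i" "0 \<le> j" "int n \<le> i * j"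
    using p by (auto elim!: hull_vertexE)
  then have "(real_of_int i, real_of_int (j + 1)) \<in> hyperbola_region n \<inter> integer_points"
    unfolding lattice_point_iff by (simp add: algebra_simps)
  then have r: "(x, y + 1) \<in> convex hull (hyperbola_region n \<inter> integer_points)"
    using ij by (simp add: hull_inc)
  define t where "t = (y - y0) / (y + 1 - y0)"
  have t: "0 < t" "t < 1" using less by (simp_all add: t_def)
  have "t * (y + 1 - y0) = y - y0" using less by (simp add: t_def)
  then have "y = (1 - t) * y0 + t * (y + 1)" by (simp add: algebra_simps)
  then have "(x, y) = (1 - t) *\<^sub>R (x, y0) + t *\<^sub>R (x, y + 1)"
    by (simp add: algebra_simps)
  then have "(x, y) \<in> open_segment (x, y0) (x, y + 1)"
    using t less by (auto simp: in_segment)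
  then show False using hull_vertex_not_between[OF p q r] by simp
qed

text \<open>Otherwise \<open>(x - 1, y)\<close> is in the region, and the vertex is the midpoint of
  it and \<open>(x + 1, y)\<close>.\<close>

lemma hull_vertex_leftmost:
  assumes p: "(real_of_int x, real_of_int y) \<in> hull_vertices n"
    and q: "0 \<le> x'" "int n \<le> x' * y"
  shows "x \<le> x'"
proof (rule ccontr)
  assume "\<not> x \<le> x'"
  then have less: "x' \<le> x - 1" by simp
  have xy: "0 \<le> x" "0 \<le> y" "int n \<le> x * y" using p by (auto elim!: hull_vertexE)
  have "x' * y \<le> (x - 1) * y" using less xy by (intro mult_right_mono) auto
  then have "(real_of_int (x - 1), real_of_int y) \<in> hyperbola_region n \<inter> integer_points"
    "(real_of_int (x + 1), real_of_int y) \<in> hyperbola_region n \<inter> integer_points"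
    unfolding lattice_point_iff using q less xy by (auto simp: algebra_simps)
  then have "(real_of_int x, real_of_int y) \<notin>
      open_segment (real_of_int (x - 1), real_of_int y) (real_of_int (x + 1), real_of_int y)"
    using hull_vertex_not_between[OF p] by (simp add: hull_inc)
  moreover have "(real_of_int x, real_of_int y) = (1 - 1/2) *\<^sub>R (real_of_int (x - 1), real_of_int y)
      + (1/2) *\<^sub>R (real_of_int (x + 1), real_of_int y)"
    by (simp add: field_simps)
  then have "(real_of_int x, real_of_int y) \<in>
      open_segment (real_of_int (x - 1), real_of_int y) (real_of_int (x + 1), real_of_int y)"
    unfolding in_segment by (intro conjI exI[of _ "1/2"]) auto
  ultimately show False by simp
qed

text \<open>A vertex \<open>(i, j)\<close> further right is leftmost in its row, so
  \<open>(a, j)\<close> is outside the region. This forces \<open>j < b\<close>,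
  \<open>1 \<le> a\<close> and \<open>1 \<le> n\<close>; then \<open>1 \<le> j\<close> gives
  \<open>2 \<le> b\<close>.\<close>

lemma hull_walk_from_vertex:
  assumes p: "(real_of_int a, real_of_int b) \<in> hull_vertices n"
    and q: "(x, y) \<in> hull_vertices n" "real_of_int a < x"
  shows "hull_walk (int n) a b"
proof -
  have ab: "0 \<le> a" "0 \<le> b" "int n \<le> a * b" using p by (auto elim!: hull_vertexE)
  obtain i j where ij: "x = real_of_int i" "y = real_of_int j" "0 \<le> i" "0 \<le> j" "int n \<le> i * j"
    using q by (auto elim!: hull_vertexE)
  have q': "(real_of_int i, real_of_int j) \<in> hull_vertices n" and "a < i" using q ij by auto
  have "\<not> int n \<le> a * j"
    using hull_vertex_leftmost[OF q', of a] ab \<open>a < i\<close> by auto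
  then have "a * j < a * b" using ab by simp
  then have jb: "j < b" and a: "1 \<le> a" using ab by (auto simp: mult_less_cancel_left)
  have n: "1 \<le> int n" using \<open>\<not> int n \<le> a * j\<close> a ij by (cases n) auto
  have "j \<noteq> 0" using ij n by auto
  have "\<not> int n \<le> a * (b - 1)"
  proof
    assume "int n \<le> a * (b - 1)"
    then have "(real_of_int a, real_of_int (b - 1)) \<in> hyperbola_region n \<inter> integer_points"
      unfolding lattice_point_iff using ab jb ij by auto
    then show False using hull_vertex_lowest[OF p, of "real_of_int (b - 1)"]
      by (simp add: hull_inc)
  qed
  then show ?thesis using n a jb ij \<open>j \<noteq> 0\<close> ab by unfold_locales auto
qed

text \<open>An open half-plane together with a ray of its boundary line. Enclosing the hull in such
  a set shows at once that the line supports the hull and where the edge on it ends.\<close>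

lemma convex_lex_halfplane:
  fixes \<alpha> \<beta> \<gamma> \<xi> :: real
  shows "convex {(x, y). \<gamma> < \<alpha> * x + \<beta> * y \<or> (\<alpha> * x + \<beta> * y = \<gamma> \<and> x \<le> \<xi>)}"
    (is "convex ?C")
proof (rule convexI)
  fix p q and s t :: real
  assume pq: "p \<in> ?C" "q \<in> ?C" and st: "0 \<le> s" "0 \<le> t" "s + t = 1"
  obtain x y x' y' where [simp]: "p = (x, y)" "q = (x', y')" by fastforce
  define h where "h = \<alpha> * x + \<beta> * y - \<gamma>"
  define h' where "h' = \<alpha> * x' + \<beta> * y' - \<gamma>"
  have t: "t = 1 - s" using st by simp
  have eq: "\<alpha> * (s * x + t * x') + \<beta> * (s * y + t * y') - \<gamma> = s * h + t * h'"
    by (simp add: h_def h'_def t algebra_simps)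
  have pq': "0 < h \<or> h = 0 \<and> x \<le> \<xi>" "0 < h' \<or> h' = 0 \<and> x' \<le> \<xi>"
    using pq by (auto simp: h_def h'_def)
  have "0 < s * h + t * h' \<or> (s * h + t * h' = 0 \<and> s * x + t * x' \<le> \<xi>)"
  proof (cases "s = 0 \<or> t = 0")
    case True
    then show ?thesis using pq' st by auto
  next
    case False
    then have pos: "0 < s" "0 < t" using st by auto
    show ?thesis
    proof (cases "h = 0 \<and> h' = 0")
      case True
      then have "x \<le> \<xi>" "x' \<le> \<xi>" using pq' by auto
      then have "s * x + t * x' \<le> \<xi>" using st by (intro convex_bound_le) auto
      then show ?thesis using True by simp
    next
      case False
      then have "0 < s * h \<and> 0 \<le> t * h' \<or> 0 \<le> s * h \<and> 0 < t * h'"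
        using pq' pos by (auto simp: zero_le_mult_iff)
      then show ?thesis by auto
    qed
  qed
  then show "s *\<^sub>R p + t *\<^sub>R q \<in> ?C" using eq by auto
qed

text \<open>A lattice point left of \<open>(a, b)\<close> lying below the line through \<open>(a, b)\<close> in direction
  \<open>(u, - v)\<close> would, together with the new vertex, put a hull point straight below the vertex
  \<open>(a, b)\<close>; hence the line supports the hull.\<close>

lemma next_vertexI:
  fixes n :: nat and a b u v k :: int
  assumes p: "(real_of_int a, real_of_int b) \<in> hull_vertices n"
    and uv: "1 \<le> u" "1 \<le> v" "coprime u v" and k: "1 \<le> k"
    and steepest: "\<And>x y. a < x \<Longrightarrow> 0 \<le> y \<Longrightarrow> int n \<le> x * y \<Longrightarrow> (b - y) * u \<le> (x - a) * v"
    and above: "0 \<le> b - k * v" "int n \<le> (a + k * u) * (b - k * v)"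
    and last: "\<And>j. k < j \<Longrightarrow> (a + j * u) * (b - j * v) < int n"
  shows "next_vertex n (real_of_int a, real_of_int b)
    (real_of_int (a + k * u), real_of_int (b - k * v))"
proof -
  let ?S = "hyperbola_region n \<inter> integer_points"
  let ?p = "(real_of_int a, real_of_int b)"
  let ?q = "(real_of_int (a + k * u), real_of_int (b - k * v))"
  have ab: "0 \<le> a" "0 \<le> b" "int n \<le> a * b" using p by (auto elim!: hull_vertexE)
  have "0 < k * u" using k uv by simp
  have q: "?q \<in> ?S" unfolding lattice_point_iff using above ab \<open>0 < k * u\<close> by simp
  have pK: "?p \<in> convex hull ?S" using p by (simp add: hull_vertices_def extreme_point_of_def)
  have below: "0 \<le> v * (x - a) + u * (y - b)" if S: "0 \<le> x" "0 \<le> y" "int n \<le> x * y" for x y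
  proof -
    have xyK: "(real_of_int x, real_of_int y) \<in> convex hull ?S"
      using lattice_point_iff S by (simp add: hull_inc)
    consider "a < x" | "x = a" | "x < a" by linarith
    then show ?thesis
    proof cases
      case 1
      then show ?thesis using steepest[of x y] S by (simp add: algebra_simps)
    next
      case 2
      then show ?thesis using hull_vertex_lowest[OF p, of y] xyK uv by simp
    next
      case 3
      define t where "t = real_of_int (a - x) / real_of_int (a + k * u - x)"
      define y0 where "y0 = (1 - t) * real_of_int y + t * real_of_int (b - k * v)"
      have d: "0 < a + k * u - x" using 3 \<open>0 < k * u\<close> by simp
      have t: "0 \<le> t" "t \<le> 1" using 3 d \<open>0 < k * u\<close> unfolding t_def
        by (simp_all del: of_int_add of_int_diff of_int_mult)
      have td: "t * real_of_int (a + k * u - x) = real_of_int (a - x)"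
        using d unfolding t_def by (simp del: of_int_add of_int_diff of_int_mult)
      then have "real_of_int a = (1 - t) * real_of_int x + t * real_of_int (a + k * u)"
        by (simp add: algebra_simps)
      then have "(real_of_int a, y0) =
          (1 - t) *\<^sub>R (real_of_int x, real_of_int y) + t *\<^sub>R ?q"
        by (simp add: y0_def)
      also have "\<dots> \<in> convex hull ?S"
        by (rule convexD_alt[OF convex_convex_hull xyK]) (use t q in \<open>auto simp: hull_inc\<close>)
      finally have "real_of_int b \<le> y0" using hull_vertex_lowest[OF p] by blast
      then have "real_of_int (a + k * u - x) * real_of_int b \<le> real_of_int (a + k * u - x) * y0"
        using d by (intro mult_left_mono) (simp_all del: of_int_add of_int_diff of_int_mult)
      also have "\<dots> = (real_of_int (a + k * u - x) - t * real_of_int (a + k * u - x)) * real_of_int y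
          + t * real_of_int (a + k * u - x) * real_of_int (b - k * v)"
        by (simp add: y0_def algebra_simps)
      also have "\<dots> = real_of_int (k * u * y + (a - x) * (b - k * v))"
        unfolding td by (simp add: algebra_simps)
      finally have "(a + k * u - x) * b \<le> k * u * y + (a - x) * (b - k * v)"
        unfolding of_int_mult[symmetric] of_int_le_iff .
      then have "0 \<le> k * (v * (x - a) + u * (y - b))" by (simp add: algebra_simps)
      then show ?thesis using k by (simp add: zero_le_mult_iff)
    qed
  qed
  \<comment> \<open>Since \<open>(u, v)\<close> is primitive, lattice points on the supporting line
    are \<open>(a + j * u, b - j * v)\<close> with integer \<open>j\<close>, and \<open>last\<close>
    bounds \<open>j\<close>.\<close>
  have line: "x \<le> a + k * u"
    if S: "0 \<le> x" "0 \<le> y" "int n \<le> x * y" and eq: "v * (x - a) + u * (y - b) = 0" for x y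
  proof -
    have e: "v * (x - a) = u * (b - y)" using eq by (simp add: algebra_simps)
    then have "u dvd v * (x - a)" by simp
    then have "u dvd x - a" using uv by (simp add: coprime_dvd_mult_right_iff)
    then obtain j where j: "x - a = u * j" by (auto elim: dvdE)
    then have "u * (v * j) = u * (b - y)" using e by (simp add: algebra_simps)
    then have "b - y = v * j" using uv by simp
    then have xy: "x = a + j * u" "y = b - j * v" using j by (simp_all add: algebra_simps)
    have "j \<le> k" using last[of j] S xy by force
    then show ?thesis using xy uv by (simp add: mult_right_mono)
  qed
  define C where "C = {(x, y). real_of_int (v * a + u * b) < real_of_int v * x + real_of_int u * y \<or>
    (real_of_int v * x + real_of_int u * y = real_of_int (v * a + u * b) \<and>
     x \<le> real_of_int (a + k * u))}"
  have "?S \<subseteq> C"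
  proof
    fix z assume "z \<in> ?S"
    then obtain x y where z: "z = (real_of_int x, real_of_int y)"
      and xy: "0 \<le> x" "0 \<le> y" "int n \<le> x * y"
      by (rule lattice_pointE)
    have "v * a + u * b < v * x + u * y \<or> (v * x + u * y = v * a + u * b \<and> x \<le> a + k * u)"
      using below[OF xy] line[OF xy] by (auto simp: algebra_simps)
    then show "z \<in> C"
      unfolding C_def z mem_Collect_eq prod.case
      unfolding of_int_mult[symmetric] of_int_add[symmetric] of_int_less_iff of_int_le_iff of_int_eq_iff .
  qed
  then have KC: "convex hull ?S \<subseteq> C"
    unfolding C_def by (intro hull_minimal convex_lex_halfplane)
  \<comment> \<open>The new point is the right end of the boundary ray of \<open>C\<close>: a
    segment of the hull through its interior point \<open>?q\<close> must lie on the line, and both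
    ends then have the abscissa of \<open>?q\<close>.\<close>
  have q_vertex: "?q \<in> hull_vertices n"
    unfolding hull_vertices_def mem_Collect_eq extreme_point_of_def
  proof (intro conjI ballI notI)
    show "?q \<in> convex hull ?S" using q by (rule hull_inc)
    fix z w assume "z \<in> convex hull ?S" "w \<in> convex hull ?S" and seg: "?q \<in> open_segment z w"
    then have zw: "z \<in> C" "w \<in> C" using KC by auto
    obtain x y x' y' where [simp]: "z = (x, y)" "w = (x', y')" by fastforce
    define h where "h = real_of_int v * x + real_of_int u * y - real_of_int (v * a + u * b)"
    define h' where "h' = real_of_int v * x' + real_of_int u * y' - real_of_int (v * a + u * b)"
    have C: "0 < h \<or> h = 0 \<and> x \<le> real_of_int (a + k * u)"
      "0 < h' \<or> h' = 0 \<and> x' \<le> real_of_int (a + k * u)"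
      using zw by (auto simp: C_def h_def h'_def)
    obtain t where t: "0 < t" "t < 1" and ne: "(x, y) \<noteq> (x', y')"
      and qx: "real_of_int (a + k * u) = (1 - t) * x + t * x'"
      and qy: "real_of_int (b - k * v) = (1 - t) * y + t * y'"
      using seg unfolding in_segment by auto
    have "(1 - t) * h + t * h' = real_of_int v * ((1 - t) * x + t * x') +
        real_of_int u * ((1 - t) * y + t * y') - real_of_int (v * a + u * b)"
      by (simp add: h_def h'_def algebra_simps)
    also have "\<dots> = 0" unfolding qx[symmetric] qy[symmetric] by (simp add: algebra_simps)
    finally have "(1 - t) * h + t * h' = 0" .
    moreover have "0 \<le> (1 - t) * h" "0 \<le> t * h'" using C t by auto
    ultimately have "(1 - t) * h = 0" "t * h' = 0" by linarith+
    then have h0: "h = 0" "h' = 0" using t by auto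
    then have le: "x \<le> real_of_int (a + k * u)" "x' \<le> real_of_int (a + k * u)" using C by auto
    have "(1 - t) * (real_of_int (a + k * u) - x) + t * (real_of_int (a + k * u) - x') = 0"
      using qx by (simp add: algebra_simps)
    moreover have "0 \<le> (1 - t) * (real_of_int (a + k * u) - x)"
      "0 \<le> t * (real_of_int (a + k * u) - x')" using le t by auto
    ultimately have "(1 - t) * (real_of_int (a + k * u) - x) = 0"
      "t * (real_of_int (a + k * u) - x') = 0" by linarith+
    then have "x = x'" using t by auto
    moreover have "real_of_int u * y = real_of_int u * y'"
      using h0 unfolding h_def h'_def \<open>x = x'\<close> by linarith
    then have "y = y'" using uv by simp
    ultimately show False using ne by simp
  qed
  \<comment> \<open>A vertex with abscissa strictly between would be on or above the chord by
    \<open>below\<close> and on or below it by \<open>hull_vertex_lowest\<close>, hence inside the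
    chord.\<close>
  have least: "real_of_int (a + k * u) \<le> x"
    if less: "real_of_int a < x" and xy: "(x, y) \<in> hull_vertices n" for x y
  proof (rule ccontr)
    assume not: "\<not> real_of_int (a + k * u) \<le> x"
    obtain i j where ij: "x = real_of_int i" "y = real_of_int j" "0 \<le> i" "0 \<le> j" "int n \<le> i * j"
      using xy by (auto elim!: hull_vertexE)
    define t where "t = (x - real_of_int a) / real_of_int (k * u)"
    have ku: "0 < real_of_int (k * u)" using \<open>0 < k * u\<close> by (simp only: of_int_0_less_iff)
    have t: "0 < t" "t < 1" using less not ku by (auto simp: t_def divide_simps)
    have tk: "t * real_of_int (k * u) = x - real_of_int a" using ku by (auto simp: t_def)
    define y0 where "y0 = (1 - t) * real_of_int b + t * real_of_int (b - k * v)"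
    have "x = (1 - t) * real_of_int a + t * real_of_int (a + k * u)"
      using tk by (simp add: algebra_simps)
    then have seg: "(x, y0) = (1 - t) *\<^sub>R ?p + t *\<^sub>R ?q" by (simp add: y0_def)
    also have "\<dots> \<in> convex hull ?S"
      by (rule convexD_alt[OF convex_convex_hull pK]) (use t q in \<open>auto simp: hull_inc\<close>)
    finally have "y \<le> y0" using hull_vertex_lowest[OF xy] by blast
    moreover have "y0 \<le> y"
    proof -
      have "0 \<le> real_of_int (v * (i - a) + u * (j - b))"
        using below ij by (simp only: of_int_0_le_iff)
      then have "0 \<le> real_of_int v * (x - real_of_int a) + real_of_int u * (y - real_of_int b)"
        by (simp add: ij)
      also have "\<dots> = real_of_int u * (y - y0)"
        unfolding tk[symmetric] by (simp add: y0_def algebra_simps)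
      finally show ?thesis using uv by (simp add: zero_le_mult_iff)
    qed
    ultimately have "(x, y) = (1 - t) *\<^sub>R ?p + t *\<^sub>R ?q" using seg by simp
    moreover have "?p \<noteq> ?q" using \<open>0 < k * u\<close> by auto
    ultimately have "(x, y) \<in> open_segment ?p ?q" using t unfolding in_segment by blast
    then show False using hull_vertex_not_between[OF xy pK] q by (simp add: hull_inc)
  qed
  have "real_of_int a < real_of_int (a + k * u)" using \<open>0 < k * u\<close> by (simp only: of_int_less_iff)
  then show ?thesis
    unfolding next_vertex_def fst_conv using q_vertex least by blast
qed

section \<open>The program\<close>

text \<open>For code without loops the relation \<open>exec\<close> reduces to a function that the
  simplifier evaluates and a static cost bound. The \<open>While\<close> clauses of the two
  functions below are placeholders.\<close>

fun loop_free :: "com \<Rightarrow> bool" where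
  "loop_free Skip = True"
| "loop_free (Store e f) = True"
| "loop_free (Seq c d) = (loop_free c \<and> loop_free d)"
| "loop_free (Cond b c d) = (loop_free c \<and> loop_free d)"
| "loop_free (While b c) = False"

fun loop_free_cost :: "com \<Rightarrow> nat" where
  "loop_free_cost Skip = 1"
| "loop_free_cost (Store e f) = acost e + acost f + 1"
| "loop_free_cost (Seq c d) = loop_free_cost c + loop_free_cost d"
| "loop_free_cost (Cond b c d) = tcost b + max (loop_free_cost c) (loop_free_cost d)"
| "loop_free_cost (While b c) = 0"

fun loop_free_result :: "com \<Rightarrow> mem \<Rightarrow> mem" where
  "loop_free_result Skip m = m"
| "loop_free_result (Store e f) m = m(aval m e := aval m f)"
| "loop_free_result (Seq c d) m = loop_free_result d (loop_free_result c m)"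
| "loop_free_result (Cond b c d) m =
     (if tval m b then loop_free_result c m else loop_free_result d m)"
| "loop_free_result (While b c) m = m"

lemma exec_loop_free:
  assumes "loop_free c"
  obtains t where "exec c m t (loop_free_result c m)" "t \<le> loop_free_cost c"
proof -
  have "\<exists>t \<le> loop_free_cost c. exec c m t (loop_free_result c m)"
    using assms
  proof (induction c arbitrary: m)
    case Skip
    then show ?case using exec_Skip[of m] by auto
  next
    case (Store e f)
    then show ?case using exec_Store[of e f m] by (auto simp del: fun_upd_apply)
  next
    case (Seq c d)
    then obtain s t where "s \<le> loop_free_cost c" "exec c m s (loop_free_result c m)"
      "t \<le> loop_free_cost d"
      "exec d (loop_free_result c m) t (loop_free_result d (loop_free_result c m))"
      by (metis loop_free.simps(3))
    then show ?case by (auto intro!: exI[of _ "s + t"] intro: exec_Seq)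
  next
    case (Cond b c d)
    then obtain s t where "s \<le> loop_free_cost c" "exec c m s (loop_free_result c m)"
      "t \<le> loop_free_cost d" "exec d m t (loop_free_result d m)"
      by (metis loop_free.simps(4))
    then show ?case
      by (intro exI[of _ "tcost b + (if tval m b then s else t)"])
        (auto intro: exec_CondT exec_CondF)
  next
    case (While b c)
    then show ?case by simp
  qed
  then show ?thesis using that by blast
qed

text \<open>Cells: 0 holds \<open>n\<close>; 1, 2 the given vertex and finally the next one; 3, 4 the admissible
  basis vector; 5, 6 the steep one; 7 the step length, whose positivity keeps the loop going;
  8 is scratch.\<close>

abbreviation cell :: "int \<Rightarrow> aexp" where
  "cell i \<equiv> Load (Const i)"

abbreviation assign :: "int \<Rightarrow> aexp \<Rightarrow> com" where
  "assign i e \<equiv> Store (Const i) e"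

definition discriminant_exp :: "aexp \<Rightarrow> aexp \<Rightarrow> aexp \<Rightarrow> aexp" where
  "discriminant_exp A B C = Plus (Times B B) (Times (Const 4) (Times A C))"

definition max_root_exp :: "aexp \<Rightarrow> aexp \<Rightarrow> aexp \<Rightarrow> aexp" where
  "max_root_exp A B C =
     IntDiv (Plus B (IntSqrt (discriminant_exp A B C))) (Times (Const 2) A)"

definition min_root_exp :: "aexp \<Rightarrow> aexp \<Rightarrow> aexp \<Rightarrow> aexp" where
  "min_root_exp A B C =
     Minus (Const 0) (IntDiv (Minus (IntSqrt (discriminant_exp A B C)) B) (Times (Const 2) A))"

definition slack_exp :: "aexp \<Rightarrow> aexp \<Rightarrow> aexp" where
  "slack_exp u v = Minus (Times (Plus (cell 1) u) (Minus (cell 2) v)) (cell 0)"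

text \<open>The linear coefficient in \<open>slack_line\<close>.\<close>

definition slope_exp :: "aexp \<Rightarrow> aexp \<Rightarrow> aexp \<Rightarrow> aexp \<Rightarrow> aexp" where
  "slope_exp u v u' v' =
     Minus (Times u' (Minus (cell 2) v)) (Times v' (Plus (cell 1) u))"

lemma aval_max_root_exp [simp]:
  "aval m (max_root_exp A B C) = max_root (aval m A) (aval m B) (aval m C)"
  by (simp add: max_root_exp_def max_root_def discriminant_exp_def)

lemma aval_min_root_exp [simp]:
  "aval m (min_root_exp A B C) = min_root (aval m A) (aval m B) (aval m C)"
  by (simp add: min_root_exp_def min_root_def discriminant_exp_def)

lemma aval_slack_exp [simp]:
  "aval m (slack_exp u v) = (m 1 + aval m u) * (m 2 - aval m v) - m 0"
  by (simp add: slack_exp_def)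

lemma aval_slope_exp [simp]:
  "aval m (slope_exp u v u' v') =
     aval m u' * (m 2 - aval m v) - aval m v' * (m 1 + aval m u)"
  by (simp add: slope_exp_def)

text \<open>Cell 4 first receives the deepest admissible descent for \<open>u = 1\<close>. If it is
  below 1, cell 3 becomes the ceiling of \<open>n / (b - 1)\<close> minus \<open>a\<close>, the
  least width of a descent by one.\<close>

definition init_walk :: com where
  "init_walk =
     Seq (assign 3 (Const 1))
    (Seq (assign 4 (IntDiv (slack_exp (Const 1) (Const 0)) (Plus (cell 1) (Const 1))))
    (Seq (assign 5 (Const 1))
    (Seq (assign 6 (Plus (cell 4) (Const 1)))
    (Seq (assign 7 (Const 1))
    (Cond (Less (cell 4) (Const 1))
      (Seq (assign 3 (Minus (Minus (Const 0)
              (IntDiv (Minus (Const 0) (cell 0)) (Minus (cell 2) (Const 1)))) (cell 1)))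
      (Seq (assign 4 (Const 1))
      (Seq (assign 5 (Minus (cell 3) (Const 1)))
           (assign 6 (Const 1)))))
      Skip)))))"

text \<open>Cell 7 is cleared if \<open>R + kL\<close> is inadmissible, which also catches junk
  values of \<open>min_root\<close>. If \<open>k \<le> 0\<close> and \<open>R + kL\<close> is
  admissible, cells 5 and 6 receive meaningless values, but the loop stops and only cells 3 and 4 of
  the basis are read afterwards.\<close>

definition walk_step :: com where
  "walk_step =
     Seq (assign 8 (max_root_exp (Times (cell 5) (cell 6))
            (slope_exp (cell 3) (cell 4) (cell 5) (cell 6)) (slack_exp (cell 3) (cell 4))))
    (Seq (assign 3 (Plus (cell 3) (Times (cell 8) (cell 5))))
    (Seq (assign 4 (Plus (cell 4) (Times (cell 8) (cell 6))))
    (Seq (assign 7 (min_root_exp (Times (cell 3) (cell 4))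
            (slope_exp (cell 5) (cell 6) (cell 3) (cell 4)) (slack_exp (cell 5) (cell 6))))
    (Cond (Less (slack_exp (Plus (cell 5) (Times (cell 7) (cell 3)))
                   (Plus (cell 6) (Times (cell 7) (cell 4)))) (Const 0))
      (assign 7 (Const 0))
      (Seq (assign 5 (Plus (cell 5) (Times (Minus (cell 7) (Const 1)) (cell 3))))
           (assign 6 (Plus (cell 6) (Times (Minus (cell 7) (Const 1)) (cell 4)))))))))"

definition walk_continues :: test where
  "walk_continues = Less (Const 0) (cell 7)"

definition go_to_end :: com where
  "go_to_end =
     Seq (assign 8 (max_root_exp (Times (cell 3) (cell 4))
            (slope_exp (Const 0) (Const 0) (cell 3) (cell 4)) (slack_exp (Const 0) (Const 0))))
    (Seq (assign 1 (Plus (cell 1) (Times (cell 8) (cell 3))))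
         (assign 2 (Minus (cell 2) (Times (cell 8) (cell 4)))))"

definition next_vertex_program :: com where
  "next_vertex_program = Seq init_walk (Seq (While walk_continues walk_step) go_to_end)"

lemma loop_free_parts: "loop_free init_walk" "loop_free walk_step" "loop_free go_to_end"
  by (simp_all add: init_walk_def walk_step_def go_to_end_def)

section \<open>Correctness of the program pieces\<close>

context hull_walk
begin

definition base_mem :: "mem \<Rightarrow> bool" where
  "base_mem m \<longleftrightarrow> m 0 = n \<and> m 1 = a \<and> m 2 = b"

definition steepest :: "int \<Rightarrow> int \<Rightarrow> bool" where
  "steepest u1 v1 \<longleftrightarrow> 1 \<le> u1 \<and> 1 \<le> v1 \<and> coprime u1 v1 \<and> 0 \<le> slack u1 v1 \<and>
     (\<forall>u v. 1 \<le> u \<longrightarrow> 0 \<le> slack u v \<longrightarrow> v * u1 \<le> u * v1)"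

lemma init_walk_result:
  assumes "base_mem m"
  defines "m' \<equiv> loop_free_result init_walk m"
  shows "base_mem m'" "0 < m' 7" "walk_inv (m' 3) (m' 4) (m' 5) (m' 6)"
proof -
  define v where "v = slack 1 0 div (a + 1)"
  define k where "k = - ((- n) div (b - 1)) - a"
  have B: "m 0 = n" "m 1 = a" "m 2 = b" using assms by (auto simp: base_mem_def)
  have v: "(a + 1) * b - n = slack 1 0" by (simp add: slack_def)
  have m': "m' = (if v < 1 then
      m(3 := k, 4 := 1, 5 := k - 1, 6 := 1, 7 := 1) else m(3 := 1, 4 := v, 5 := 1, 6 := v + 1, 7 := 1))"
    by (simp add: m'_def init_walk_def B v v_def[symmetric] k_def[symmetric] fun_eq_iff)
  then show "base_mem m'" "0 < m' 7" by (auto simp: base_mem_def B)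
  have le_v: "w \<le> v \<longleftrightarrow> 0 \<le> slack 1 w" for w
    using a_pos le_div_iff_int[of "a + 1" w "slack 1 0"] by (auto simp: v_def slack_def algebra_simps)
  have k_le: "k \<le> w \<longleftrightarrow> 0 \<le> slack w 1" for w
    using b_ge minus_div_le_iff_int[of "b - 1" "- n" "w + a"]
    by (auto simp: k_def slack_def algebra_simps)
  \<comment> \<open>With \<open>start_low\<close> this gives \<open>1 < n\<close>, the invariant
    \<open>u2 < n\<close> for the initial \<open>u2 = 1\<close>.\<close>
  have "1 * 1 \<le> a * (b - 1)" using a_pos b_ge by (intro mult_mono) auto
  then have "1 < n" using start_low by simp
  show "walk_inv (m' 3) (m' 4) (m' 5) (m' 6)"
  proof (cases "v < 1")
    case True
    then show ?thesis
      using walk_inv_init_horizontal[of k] le_v[of 1] k_le[of k] k_le[of "k - 1"] by (simp add: m')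
  next
    case False
    then show ?thesis
      using walk_inv_init_diagonal[of v] le_v[of v] le_v[of "v + 1"] \<open>1 < n\<close> by (simp add: m')
  qed
qed

lemma walk_step_result:
  assumes "base_mem m" and inv: "walk_inv (m 3) (m 4) (m 5) (m 6)"
  defines "m' \<equiv> loop_free_result walk_step m"
  shows "base_mem m'"
    and "0 < m' 7 \<Longrightarrow> walk_inv (m' 3) (m' 4) (m' 5) (m' 6) \<and> 2 * m 5 \<le> m' 5"
    and "m' 7 \<le> 0 \<Longrightarrow> steepest (m' 3) (m' 4)"
proof -
  define u2 where "u2 = m 5"
  define v2 where "v2 = m 6"
  define j where "j = max_root (u2 * v2) (u2 * (b - m 4) - v2 * (a + m 3)) (slack (m 3) (m 4))"
  define u1 where "u1 = m 3 + j * u2"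
  define v1 where "v1 = m 4 + j * v2"
  define k where "k = min_root (u1 * v1) (u1 * (b - v2) - v1 * (a + u2)) (slack u2 v2)"
  have B: "m 0 = n" "m 1 = a" "m 2 = b" using assms by (auto simp: base_mem_def)
  have s: "(a + u) * (b - v) - n = slack u v" "(a + u) * (b - v) < n \<longleftrightarrow> slack u v < 0" for u v
    by (simp_all add: slack_def)
  have m': "m' = (if slack (u2 + k * u1) (v2 + k * v1) < 0
      then m(8 := j, 3 := u1, 4 := v1, 7 := 0)
      else m(8 := j, 3 := u1, 4 := v1, 7 := k, 5 := u2 + (k - 1) * u1, 6 := v2 + (k - 1) * v1))"
    unfolding m'_def walk_step_def
    by (simp add: B s u2_def[symmetric] v2_def[symmetric] j_def[symmetric] u1_def[symmetric]
        v1_def[symmetric] k_def[symmetric] cong: if_cong)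
  then show "base_mem m'" by (auto simp: base_mem_def B)
  note ext = walk_extend[OF inv, folded u2_def v2_def, folded j_def, folded u1_def v1_def]
  show "walk_inv (m' 3) (m' 4) (m' 5) (m' 6) \<and> 2 * m 5 \<le> m' 5" if "0 < m' 7"
    using that walk_advance[OF ext, folded k_def] by (auto simp: m' u2_def[symmetric] split: if_splits)
  show "steepest (m' 3) (m' 4)" if "m' 7 \<le> 0"
  proof -
    have k: "k \<le> 0 \<or> slack (u2 + k * u1) (v2 + k * v1) < 0"
      using that by (auto simp: m' split: if_splits)
    note I = ext(1)[unfolded walk_inv_def]
    have "coprime u1 v1"
    proof (rule coprimeI)
      fix d assume "d dvd u1" "d dvd v1"
      then have "d dvd u1 * v2 - u2 * v1" by simp
      then show "is_unit d" using I by simp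
    qed
    then have "steepest u1 v1"
      using I walk_exit[OF ext(1), folded k_def, OF k] by (simp add: steepest_def)
    then show ?thesis by (simp add: m')
  qed
qed

text \<open>Cell 5 doubles in every continuing round, so \<open>r\<close> drops by one while
  \<open>n \<le> m 5 * 2 ^ r\<close> persists; \<open>r = 0\<close> contradicts
  \<open>u2 < n\<close>. The extra unit in \<open>Suc r\<close> pays for the final failing
  test.\<close>

lemma walk_terminates:
  assumes "base_mem m" "0 < m 7" "walk_inv (m 3) (m 4) (m 5) (m 6)" "n \<le> m 5 * 2 ^ r"
  shows "\<exists>t m'. exec (While walk_continues walk_step) m t m' \<and>
    t \<le> (tcost walk_continues + loop_free_cost walk_step) * Suc r \<and>
    base_mem m' \<and> steepest (m' 3) (m' 4)"
  using assms
proof (induction r arbitrary: m)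
  case 0
  then show ?case by (simp add: walk_inv_def)
next
  case (Suc r)
  define m1 where "m1 = loop_free_result walk_step m"
  obtain s where s: "exec walk_step m s m1" "s \<le> loop_free_cost walk_step"
    unfolding m1_def by (rule exec_loop_free[OF loop_free_parts(2)])
  have test: "tval m walk_continues" using Suc.prems by (simp add: walk_continues_def)
  note step = walk_step_result[OF Suc.prems(1,3), folded m1_def]
  let ?K = "tcost walk_continues + loop_free_cost walk_step"
  show ?case
  proof (cases "0 < m1 7")
    case True
    have "m 5 * 2 ^ Suc r = (2 * m 5) * 2 ^ r" by simp
    also have "\<dots> \<le> m1 5 * 2 ^ r" using step(2)[OF True] by (intro mult_right_mono) auto
    finally have "n \<le> m1 5 * 2 ^ r" using Suc.prems by linarith
    then obtain t m' where t: "exec (While walk_continues walk_step) m1 t m'" "t \<le> ?K * Suc r"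
      and m': "base_mem m'" "steepest (m' 3) (m' 4)"
      using Suc.IH[of m1] step True by blast
    have "exec (While walk_continues walk_step) m (tcost walk_continues + s + t) m'"
      using exec_WhileT[OF test s(1) t(1)] .
    moreover have "tcost walk_continues + s + t \<le> ?K * Suc (Suc r)" using s t by simp
    ultimately show ?thesis using m' by blast
  next
    case False
    then have "exec (While walk_continues walk_step) m1 (tcost walk_continues) m1"
      by (intro exec_WhileF) (simp add: walk_continues_def)
    then have "exec (While walk_continues walk_step) m (tcost walk_continues + s + tcost walk_continues) m1"
      using exec_WhileT[OF test s(1)] by blast
    moreover have "tcost walk_continues + s + tcost walk_continues \<le> ?K * Suc (Suc r)" using s by simp
    ultimately show ?thesis using step False by force
  qed
qed

lemma go_to_end_result:
  assumes "base_mem m" and steepest: "steepest (m 3) (m 4)"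
    and n: "n = int N" and p: "(real_of_int a, real_of_int b) \<in> hull_vertices N"
  defines "m' \<equiv> loop_free_result go_to_end m"
  shows "next_vertex N (real_of_int a, real_of_int b) (real_of_int (m' 1), real_of_int (m' 2))"
proof -
  define u where "u = m 3"
  define v where "v = m 4"
  note I = steepest[folded u_def v_def, unfolded steepest_def]
  define k where "k = max_root (u * v) (u * (b - 0) - v * (a + 0)) (slack 0 0)"
  have B: "m 0 = n" "m 1 = a" "m 2 = b" using assms(1) by (simp_all add: base_mem_def)
  have m': "m' 1 = a + k * u" "m' 2 = b - k * v"
    by (simp_all add: m'_def go_to_end_def B u_def[symmetric] v_def[symmetric] k_def slack_def)
  have A: "0 < u * v" using I by simp
  have s0: "0 \<le> slack 0 0" using start_above by (simp add: slack_def)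
  note root = max_root[OF A s0, of "u * (b - 0) - v * (a + 0)", folded k_def, folded slack_line,
      simplified]
  \<comment> \<open>The multiple 1, that is \<open>L\<close> itself, is admissible.\<close>
  have k: "1 \<le> k" using root(3)[of 1] I by force
  have "0 \<le> k * u" using k I by simp
  then have kv: "k * v < b" using root slack_nonneg_height by blast
  show ?thesis
    unfolding m'
  proof (rule next_vertexI[OF p])
    show "(b - y) * u \<le> (x - a) * v" if "a < x" "0 \<le> y" "int N \<le> x * y" for x y
    proof -
      have "0 \<le> slack (x - a) (b - y)" using that by (simp add: slack_def n[symmetric])
      then show ?thesis using I that by simp
    qed
    show "int N \<le> (a + k * u) * (b - k * v)" using root(2) by (simp add: slack_def n[symmetric])
    show "(a + j * u) * (b - j * v) < int N" if "k < j" for j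
      using root(3)[OF that] by (simp add: slack_def n[symmetric])
  qed (use I k kv in auto)
qed

end

section \<open>Total cost and correctness\<close>

definition next_vertex_cost :: "nat \<Rightarrow> nat" where
  "next_vertex_cost n = loop_free_cost init_walk
     + (tcost walk_continues + loop_free_cost walk_step) * Suc (nat \<lceil>log 2 (real n)\<rceil>)
     + loop_free_cost go_to_end"

lemma next_vertex_program_correct:
  assumes p: "(real_of_int a, real_of_int b) \<in> hull_vertices n"
    and q: "(x, y) \<in> hull_vertices n" "real_of_int a < x"
  shows "\<exists>t m. exec next_vertex_program (input_mem n a b) t m \<and> t \<le> next_vertex_cost n \<and>
    next_vertex n (real_of_int a, real_of_int b) (real_of_int (m 1), real_of_int (m 2))"
proof -
  interpret hull_walk "int n" a b by (rule hull_walk_from_vertex[OF p q])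
  define m0 where "m0 = input_mem n a b"
  define m1 where "m1 = loop_free_result init_walk m0"
  have "base_mem m0" by (simp add: base_mem_def m0_def input_mem_def)
  note m1 = init_walk_result[OF this, folded m1_def]
  obtain t1 where t1: "exec init_walk m0 t1 m1" "t1 \<le> loop_free_cost init_walk"
    unfolding m1_def by (rule exec_loop_free[OF loop_free_parts(1)])
  define r where "r = nat \<lceil>log 2 (real n)\<rceil>"
  have "real n \<le> 2 ^ r"
  proof -
    have "real n = 2 powr log 2 (real n)" using n_pos by simp
    also have "\<dots> \<le> 2 powr real r" unfolding r_def by (intro powr_mono) linarith+
    finally show ?thesis by (simp add: powr_realpow)
  qed
  then have "real_of_int (int n) \<le> real_of_int (2 ^ r)" by simp
  then have "int n \<le> 1 * 2 ^ r" by (simp only: of_int_le_iff mult_1)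
  also have "\<dots> \<le> m1 5 * 2 ^ r" using m1 by (intro mult_right_mono) (auto simp: walk_inv_def)
  finally obtain t2 m2 where t2: "exec (While walk_continues walk_step) m1 t2 m2"
      "t2 \<le> (tcost walk_continues + loop_free_cost walk_step) * Suc r"
    and m2: "base_mem m2" "steepest (m2 3) (m2 4)"
    using walk_terminates[OF m1] by blast
  define m3 where "m3 = loop_free_result go_to_end m2"
  obtain t3 where t3: "exec go_to_end m2 t3 m3" "t3 \<le> loop_free_cost go_to_end"
    unfolding m3_def by (rule exec_loop_free[OF loop_free_parts(3)])
  have "exec next_vertex_program m0 (t1 + (t2 + t3)) m3"
    unfolding next_vertex_program_def by (intro exec_Seq[OF t1(1)] exec_Seq[OF t2(1)] t3(1))
  moreover have "t1 + (t2 + t3) \<le> next_vertex_cost n"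
    using t1 t2 t3 unfolding next_vertex_cost_def r_def by linarith
  ultimately show ?thesis
    using go_to_end_result[OF m2 refl p, folded m3_def] unfolding m0_def by blast
qed

lemma next_vertex_cost_bigo: "(\<lambda>n. real (next_vertex_cost n)) \<in> O(\<lambda>n. ln (real n))"
proof -
  define K where "K = real (tcost walk_continues + loop_free_cost walk_step)"
  define K' where "K' = real (loop_free_cost init_walk + loop_free_cost go_to_end)"
  have "K \<ge> 0" "K' \<ge> 0" by (simp_all add: K_def K'_def)
  show ?thesis
  \<comment> \<open>For \<open>n \<ge> 2\<close> the binary logarithm is at least 1, so it absorbs
    the fixed cost \<open>K'\<close>, and the number of rounds is at most
    \<open>log 2 n + 2 \<le> 3 * log 2 n\<close>. Division by \<open>ln 2\<close> changes the
    base.\<close>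
  proof (rule bigoI[where c = "K' / ln 2 + 3 * K / ln 2"], rule eventually_sequentiallyI[of 2])
    fix n :: nat assume n: "2 \<le> n"
    have log: "1 \<le> log 2 (real n)" using n by simp
    have "real (nat \<lceil>log 2 (real n)\<rceil>) \<le> log 2 (real n) + 1"
      using log by linarith
    then have "real (Suc (nat \<lceil>log 2 (real n)\<rceil>)) \<le> 3 * log 2 (real n)" using log by linarith
    then have "K * real (Suc (nat \<lceil>log 2 (real n)\<rceil>)) \<le> K * (3 * log 2 (real n))"
      using \<open>K \<ge> 0\<close> by (rule mult_left_mono)
    moreover have "K' * 1 \<le> K' * log 2 (real n)" using log \<open>K' \<ge> 0\<close> by (rule mult_left_mono)
    moreover have "real (next_vertex_cost n) = K' + K * real (Suc (nat \<lceil>log 2 (real n)\<rceil>))"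
      unfolding next_vertex_cost_def K_def K'_def of_nat_add of_nat_mult by simp
    ultimately have "real (next_vertex_cost n) \<le> K' * log 2 (real n) + K * (3 * log 2 (real n))"
      by linarith
    also have "\<dots> = (K' / ln 2 + 3 * K / ln 2) * ln (real n)"
      by (simp add: log_def field_simps)
    finally show "norm (real (next_vertex_cost n)) \<le> (K' / ln 2 + 3 * K / ln 2) * norm (ln (real n))"
      using n by simp
  qed
qed

theorem theorem1p3:
  shows "\<exists>(c :: com) (T :: nat \<Rightarrow> nat).
    (\<lambda>n. real (T n)) \<in> O(\<lambda>n. ln (real n)) \<and>
    (\<forall>(n :: nat) (a :: int) (b :: int).
       (real_of_int a, real_of_int b) \<in> hull_vertices n \<and>
       {x. x > real_of_int a \<and> (\<exists>y. (x, y) \<in> hull_vertices n)} \<noteq> {} \<longrightarrow>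
       (\<exists>t m. exec c (input_mem n a b) t m \<and> t \<le> T n \<and>
          next_vertex n (real_of_int a, real_of_int b) (real_of_int (m 1), real_of_int (m 2))))"
proof (rule exI[of _ next_vertex_program], rule exI[of _ next_vertex_cost],
    intro conjI allI impI)
  show "(\<lambda>n. real (next_vertex_cost n)) \<in> O(\<lambda>n. ln (real n))" by (rule next_vertex_cost_bigo)
  fix n :: nat and a b :: int
  assume "(real_of_int a, real_of_int b) \<in> hull_vertices n \<and>
    {x. x > real_of_int a \<and> (\<exists>y. (x, y) \<in> hull_vertices n)} \<noteq> {}"
  then show "\<exists>t m. exec next_vertex_program (input_mem n a b) t m \<and> t \<le> next_vertex_cost n \<and>
      next_vertex n (real_of_int a, real_of_int b) (real_of_int (m 1), real_of_int (m 2))"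
    using next_vertex_program_correct by blast
qed

end
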